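(* Let $n\geq 3$ be a natural number. In the basic Fraenkel model $\mathcal{V}_{F_0}$, with $A$ its set of atoms, there is no injection from $C_n(A)$ into $\textup{Part}(A)$, i.e. $\mathcal{V}_{F_0}\vDash |C_n(A)|\nleq|\textup{Part}(A)|$.
   Context: The basic Fraenkel model $\mathcal{V}_{F_0}$ is the permutation model of ZFA (set theory with atoms) determined by a countably infinite set $A$ of atoms, the group $\mathcal{G}$ of all permutations of $A$ (extended to the universe $V$ of sets over $A$ in the usual way, fixing pure sets), and the normal ideal of finite subsets of $A$: it consists of those $x$ (hereditarily) having a finite support $E\subseteq A$, meaning every $\pi\in\mathcal{G}$ fixing $E$ pointwise satisfies $\pi x=x$. For a set $X$, $\textup{Part}(X)$ is the set of all partitions of $X$, and $C_n(X)$ is the set of permutations of $X$ that are cycles with exactly $n$ non-fixed points (i.e. cyclic permutations $(a_0;a_1;\ldots;a_{n-1})$ with $a_0\mapsto a_1\mapsto\cdots\mapsto a_{n-1}\mapsto a_0$ and all other points fixed). *)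

theory Defs
  imports Main "HOL-Library.Countable_Set" "HOL-Combinatorics.Permutations"
begin

section \<open>The universe of sets over a set of atoms\<close>

text \<open>
  The ambient universe \<open>V\<close> of ZFA is a type \<open>'v\<close> with \<open>elts x\<close> the collection of members
  of \<open>x\<close>. As usual for set theory inside HOL, separation and replacement are stated for arbitrary
  HOL predicates and functions, so choice in \<open>V\<close> is inherited from HOL.
  Atoms and the empty set all have no members; only non-atoms are sets.
\<close>

locale zfa_universe =
  fixes elts :: "'v \<Rightarrow> 'v set" and Atoms :: "'v set"
  assumes atoms_no_members: "a \<in> Atoms \<Longrightarrow> elts a = {}"
    and extensionality: "x \<notin> Atoms \<Longrightarrow> y \<notin> Atoms \<Longrightarrow> elts x = elts y \<Longrightarrow> x = y"
    and foundation: "wf {(x, y). x \<in> elts y}"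
    and set_of_atoms: "\<exists>z. z \<notin> Atoms \<and> elts z = Atoms"
    and pairing: "\<exists>z. z \<notin> Atoms \<and> elts z = {x, y}"
    and union: "\<exists>z. z \<notin> Atoms \<and> elts z = \<Union> (elts ` elts x)"
    and power_set: "\<exists>z. z \<notin> Atoms \<and> elts z = {y. y \<notin> Atoms \<and> elts y \<subseteq> elts x}"
    and infinity: "\<exists>w. w \<notin> Atoms \<and> (\<exists>e \<in> elts w. e \<notin> Atoms \<and> elts e = {}) \<and>
      (\<forall>y \<in> elts w. \<exists>s \<in> elts w. s \<notin> Atoms \<and> elts s = insert y (elts y))"
    and separation: "\<exists>z. z \<notin> Atoms \<and> elts z = {y \<in> elts x. Q y}"
    and replacement: "\<exists>z. z \<notin> Atoms \<and> elts z = f ` elts x"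
begin

definition set_of :: "'v set \<Rightarrow> 'v" where
  "set_of X = (THE x. x \<notin> Atoms \<and> elts x = X)"

function perm_ext :: "('v \<Rightarrow> 'v) \<Rightarrow> 'v \<Rightarrow> 'v" where
  "perm_ext \<pi> x = (if x \<in> Atoms then \<pi> x else set_of (perm_ext \<pi> ` elts x))"
  by pat_completeness auto
termination
proof (relation "inv_image {(x, y). x \<in> elts y} snd")
  show "wf (inv_image {(x, y). x \<in> elts y} (snd :: ('v \<Rightarrow> 'v) \<times> 'v \<Rightarrow> 'v))"
    using foundation by (rule wf_inv_image)
qed simp

declare perm_ext.simps [simp del]

definition supports :: "'v set \<Rightarrow> 'v \<Rightarrow> bool" where
  "supports E x \<longleftrightarrow>
    (\<forall>\<pi>. \<pi> permutes Atoms \<and> (\<forall>a \<in> E. \<pi> a = a) \<longrightarrow> perm_ext \<pi> x = x)"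

definition symmetric :: "'v \<Rightarrow> bool" where
  "symmetric x \<longleftrightarrow> (\<exists>E. finite E \<and> E \<subseteq> Atoms \<and> supports E x)"

text \<open>The basic Fraenkel model arises from this when \<open>Atoms\<close> is countably infinite.\<close>

definition fraenkel_model :: "'v set" where
  "fraenkel_model = {x. \<forall>y. (y, x) \<in> {(u, v). u \<in> elts v}\<^sup>* \<longrightarrow> symmetric y}"

lemma fraenkel_model_transitive:
  "x \<in> fraenkel_model \<Longrightarrow> y \<in> elts x \<Longrightarrow> y \<in> fraenkel_model"
  unfolding fraenkel_model_def by (auto intro: rtrancl_into_rtrancl)

end


section \<open>Set-theoretic notions interpreted in a structure\<close>

text \<open>
  All quantifiers over sets and atoms range over the domain \<open>U\<close>, so that for instance
  \<open>is_injection f X Y\<close> says that the structure \<open>U\<close> satisfies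
  ``\<open>f\<close> is an injection from \<open>X\<close> to \<open>Y\<close>''.
\<close>

locale zfa_structure =
  fixes U :: "'v set" and elts :: "'v \<Rightarrow> 'v set" and Atoms :: "'v set"
begin

definition is_set :: "'v \<Rightarrow> bool" where
  "is_set x \<longleftrightarrow> x \<in> U \<and> x \<notin> Atoms"

definition is_upair :: "'v \<Rightarrow> 'v \<Rightarrow> 'v \<Rightarrow> bool" where
  "is_upair x y z \<longleftrightarrow> is_set z \<and> (\<forall>w \<in> U. w \<in> elts z \<longleftrightarrow> w = x \<or> w = y)"

definition is_opair :: "'v \<Rightarrow> 'v \<Rightarrow> 'v \<Rightarrow> bool" where
  "is_opair x y p \<longleftrightarrow>
    (\<exists>u \<in> U. \<exists>v \<in> U. is_upair x x u \<and> is_upair x y v \<and> is_upair u v p)"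

definition maps_to :: "'v \<Rightarrow> 'v \<Rightarrow> 'v \<Rightarrow> bool" where
  "maps_to f x y \<longleftrightarrow> (\<exists>p \<in> U. p \<in> elts f \<and> is_opair x y p)"

definition is_function :: "'v \<Rightarrow> 'v \<Rightarrow> 'v \<Rightarrow> bool" where
  "is_function f X Y \<longleftrightarrow> is_set f \<and>
    (\<forall>p \<in> U. p \<in> elts f \<longrightarrow>
      (\<exists>x \<in> U. \<exists>y \<in> U. x \<in> elts X \<and> y \<in> elts Y \<and> is_opair x y p)) \<and>
    (\<forall>x \<in> U. x \<in> elts X \<longrightarrow> (\<exists>!y. y \<in> U \<and> maps_to f x y))"

definition is_injection :: "'v \<Rightarrow> 'v \<Rightarrow> 'v \<Rightarrow> bool" where
  "is_injection f X Y \<longleftrightarrow> is_function f X Y \<and>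
    (\<forall>x \<in> U. \<forall>x' \<in> U. \<forall>y \<in> U. maps_to f x y \<and> maps_to f x' y \<longrightarrow> x = x')"

definition card_le :: "'v \<Rightarrow> 'v \<Rightarrow> bool" where
  "card_le X Y \<longleftrightarrow> (\<exists>f \<in> U. is_injection f X Y)"

definition is_permutation :: "'v \<Rightarrow> 'v \<Rightarrow> bool" where
  "is_permutation g X \<longleftrightarrow> is_injection g X X \<and>
    (\<forall>y \<in> U. y \<in> elts X \<longrightarrow> (\<exists>x \<in> U. maps_to g x y))"

text \<open>For \<open>n \<ge> 2\<close>, the non-fixed points of such a \<open>g\<close> are exactly the \<open>n\<close> points \<open>a i\<close>.\<close>

definition is_cycle :: "nat \<Rightarrow> 'v \<Rightarrow> 'v \<Rightarrow> bool" where
  "is_cycle n g X \<longleftrightarrow> is_permutation g X \<and>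
    (\<exists>a. (\<forall>i<n. a i \<in> U \<and> a i \<in> elts X) \<and> inj_on a {..<n} \<and>
      (\<forall>i<n. maps_to g (a i) (a (Suc i mod n))) \<and>
      (\<forall>x \<in> U. x \<in> elts X \<and> x \<notin> a ` {..<n} \<longrightarrow> maps_to g x x))"

definition is_partition :: "'v \<Rightarrow> 'v \<Rightarrow> bool" where
  "is_partition p X \<longleftrightarrow> is_set p \<and>
    (\<forall>b \<in> U. b \<in> elts p \<longrightarrow> is_set b \<and> (\<exists>x \<in> U. x \<in> elts b)) \<and>
    (\<forall>b \<in> U. \<forall>c \<in> U. b \<in> elts p \<and> c \<in> elts p \<and> b \<noteq> c \<longrightarrow>
      \<not> (\<exists>x \<in> U. x \<in> elts b \<and> x \<in> elts c)) \<and>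
    (\<forall>x \<in> U. x \<in> elts X \<longleftrightarrow> (\<exists>b \<in> U. b \<in> elts p \<and> x \<in> elts b))"

text \<open>\<open>A\<close> is the set of atoms, \<open>C\<close> is \<open>C\<^sub>n(X)\<close>, and \<open>P\<close> is \<open>Part(X)\<close>.\<close>

definition is_atom_set :: "'v \<Rightarrow> bool" where
  "is_atom_set A \<longleftrightarrow> is_set A \<and> (\<forall>x \<in> U. x \<in> elts A \<longleftrightarrow> x \<in> Atoms)"

definition is_Cycles :: "nat \<Rightarrow> 'v \<Rightarrow> 'v \<Rightarrow> bool" where
  "is_Cycles n X C \<longleftrightarrow> is_set C \<and> (\<forall>g \<in> U. g \<in> elts C \<longleftrightarrow> is_cycle n g X)"

definition is_Part :: "'v \<Rightarrow> 'v \<Rightarrow> bool" where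
  "is_Part X P \<longleftrightarrow> is_set P \<and> (\<forall>p \<in> U. p \<in> elts P \<longleftrightarrow> is_partition p X)"

end

text \<open>
  The sets described by these predicates are unique in the model, so they may be introduced
  by existential quantifiers.
\<close>

context zfa_universe
begin

interpretation F: zfa_structure fraenkel_model elts Atoms .

lemma fraenkel_model_ext:
  assumes "F.is_set x" "F.is_set y" "\<And>z. z \<in> fraenkel_model \<Longrightarrow> z \<in> elts x \<longleftrightarrow> z \<in> elts y"
  shows "x = y"
  using assms fraenkel_model_transitive unfolding F.is_set_def
  by (blast intro: extensionality)

lemma fraenkel_model_unique:
  shows "F.is_atom_set A \<Longrightarrow> F.is_atom_set A' \<Longrightarrow> A = A'"
    and "F.is_Cycles n X C \<Longrightarrow> F.is_Cycles n X C' \<Longrightarrow> C = C'"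
    and "F.is_Part X P \<Longrightarrow> F.is_Part X P' \<Longrightarrow> P = P'"
  unfolding F.is_atom_set_def F.is_Cycles_def F.is_Part_def
  by (auto intro: fraenkel_model_ext)

end

end

theory Submission
  imports Defs
begin

text \<open>
  Let \<open>f\<close> be an injection from \<open>C\<^sub>n(A)\<close> into \<open>Part(A)\<close> with finite support \<open>E\<close>, let \<open>g\<close> be an
  \<open>n\<close>-cycle on atoms \<open>\<alpha> i\<close> (\<open>i\<close> taken modulo \<open>n\<close>) outside \<open>E\<close>, and let \<open>p = f(g)\<close>. Every rotation
  \<open>\<alpha> i \<mapsto> \<alpha> (i + k)\<close> fixes \<open>f\<close> and \<open>g\<close>, hence \<open>p\<close>. The reflection \<open>\<alpha> i \<mapsto> \<alpha> (- i)\<close> then also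
  fixes \<open>p\<close>: on the unordered pair \<open>{\<alpha> i, \<alpha> j}\<close> it agrees with the rotation by \<open>- i - j\<close>, and on
  \<open>{\<alpha> i, y}\<close> with \<open>y\<close> off the cycle it agrees with the rotation by \<open>- 2 i\<close>, so it preserves the
  equivalence relation of \<open>p\<close>. As it also fixes \<open>f\<close>, injectivity shows that it fixes \<open>g\<close>; but it
  inverts \<open>g\<close>, and \<open>g\<close> is not an involution for \<open>n \<ge> 3\<close>.
\<close>

section \<open>Automorphisms of a structure\<close>

text \<open>The predicates of \<open>zfa_structure\<close> are built from membership,
  \<open>Atoms\<close> and quantifiers over \<open>U\<close>, so a bijection respecting these three
  preserves their truth. The instance used is \<sigma> = \<open>perm_ext \<pi>\<close>.\<close>

locale zfa_automorphism = zfa_structure U elts Atoms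
  for U :: "'v set" and elts :: "'v \<Rightarrow> 'v set" and Atoms :: "'v set" +
  fixes \<sigma> :: "'v \<Rightarrow> 'v"
  assumes bij: "bij \<sigma>"
    and U_iff [simp]: "\<sigma> x \<in> U \<longleftrightarrow> x \<in> U"
    and Atoms_iff [simp]: "\<sigma> x \<in> Atoms \<longleftrightarrow> x \<in> Atoms"
    and elts_image: "elts (\<sigma> x) = \<sigma> ` elts x"
begin

lemma eq_iff [simp]: "\<sigma> x = \<sigma> y \<longleftrightarrow> x = y"
  using bij by (meson bij_is_inj inj_eq)

lemma mem_iff [simp]: "\<sigma> x \<in> elts (\<sigma> y) \<longleftrightarrow> x \<in> elts y"
  by (auto simp: elts_image)

lemma obtain_preimage: obtains x where "y = \<sigma> x"
  using bij by (metis bij_pointE)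

text \<open>Reindexing a quantifier along \<sigma>, which permutes \<open>U\<close>. This and the
  two rules after it let the invariance proofs descend through the definitions.\<close>

lemma ball_U_cong:
  assumes "\<And>x. x \<in> U \<Longrightarrow> Q (\<sigma> x) \<longleftrightarrow> R x"
  shows "(\<forall>x \<in> U. Q x) \<longleftrightarrow> (\<forall>x \<in> U. R x)"
  using assms by (metis U_iff obtain_preimage)

lemma bex_U_cong:
  assumes "\<And>x. x \<in> U \<Longrightarrow> Q (\<sigma> x) \<longleftrightarrow> R x"
  shows "(\<exists>x \<in> U. Q x) \<longleftrightarrow> (\<exists>x \<in> U. R x)"
  using assms by (metis U_iff obtain_preimage)

lemma ex1_cong:
  assumes "\<And>x. Q (\<sigma> x) \<longleftrightarrow> R x"
  shows "(\<exists>!x. Q x) \<longleftrightarrow> (\<exists>!x. R x)"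
  using assms by (metis eq_iff obtain_preimage)

lemma is_set_iff [simp]: "is_set (\<sigma> x) \<longleftrightarrow> is_set x"
  by (simp add: is_set_def)

lemma is_upair_iff [simp]: "is_upair (\<sigma> x) (\<sigma> y) (\<sigma> z) \<longleftrightarrow> is_upair x y z"
  unfolding is_upair_def by (intro conj_cong ball_U_cong) simp_all

lemma is_opair_iff [simp]: "is_opair (\<sigma> x) (\<sigma> y) (\<sigma> p) \<longleftrightarrow> is_opair x y p"
  unfolding is_opair_def by (intro bex_U_cong) simp_all

lemma maps_to_iff [simp]: "maps_to (\<sigma> f) (\<sigma> x) (\<sigma> y) \<longleftrightarrow> maps_to f x y"
  unfolding maps_to_def by (intro bex_U_cong) simp_all

lemma is_function_iff [simp]: "is_function (\<sigma> f) (\<sigma> X) (\<sigma> Y) \<longleftrightarrow> is_function f X Y"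
  unfolding is_function_def
  by (intro conj_cong ball_U_cong imp_cong bex_U_cong ex1_cong) simp_all

lemma is_injection_iff [simp]: "is_injection (\<sigma> f) (\<sigma> X) (\<sigma> Y) \<longleftrightarrow> is_injection f X Y"
  unfolding is_injection_def by (intro conj_cong ball_U_cong) simp_all

lemma is_permutation_iff [simp]: "is_permutation (\<sigma> g) (\<sigma> X) \<longleftrightarrow> is_permutation g X"
  unfolding is_permutation_def by (intro conj_cong ball_U_cong imp_cong bex_U_cong) simp_all

lemma is_partition_iff [simp]: "is_partition (\<sigma> p) (\<sigma> X) \<longleftrightarrow> is_partition p X"
proof -
  \<comment> \<open>The two nested existentials are treated beforehand: one stands under a negation,
    the other on the right of an equivalence.\<close>
  have disjoint: "\<not> (\<exists>x \<in> U. x \<in> elts (\<sigma> b) \<and> x \<in> elts (\<sigma> c)) \<longleftrightarrow>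
      \<not> (\<exists>x \<in> U. x \<in> elts b \<and> x \<in> elts c)" for b c
    by (intro arg_cong [of _ _ Not] bex_U_cong) simp
  have cover: "(\<exists>b \<in> U. b \<in> elts (\<sigma> p) \<and> \<sigma> x \<in> elts b) \<longleftrightarrow>
      (\<exists>b \<in> U. b \<in> elts p \<and> x \<in> elts b)" for x
    by (intro bex_U_cong) simp
  show ?thesis
    unfolding is_partition_def
    by (intro conj_cong ball_U_cong imp_cong [OF _ disjoint] imp_cong [OF _ conj_cong] bex_U_cong)
      (simp_all add: cover)
qed

text \<open>The points of the cycle are listed by a function of HOL and not by an element of
  \<open>U\<close>, so the listing is transported to \<open>\<sigma> \<circ> a\<close> by
  hand.\<close>

lemma is_cycle_image:
  assumes "is_cycle n g X"
  shows "is_cycle n (\<sigma> g) (\<sigma> X)"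
proof -
  obtain a where perm: "is_permutation g X"
    and a: "\<And>i. i < n \<Longrightarrow> a i \<in> U \<and> a i \<in> elts X" and inj: "inj_on a {..<n}"
    and step: "\<And>i. i < n \<Longrightarrow> maps_to g (a i) (a (Suc i mod n))"
    and fixed: "\<And>x. x \<in> U \<Longrightarrow> x \<in> elts X \<Longrightarrow> x \<notin> a ` {..<n} \<Longrightarrow> maps_to g x x"
    using assms unfolding is_cycle_def by blast
  have "maps_to (\<sigma> g) x x" if "x \<in> U" "x \<in> elts (\<sigma> X)" "x \<notin> (\<sigma> \<circ> a) ` {..<n}" for x
  proof -
    obtain y where y: "x = \<sigma> y" by (rule obtain_preimage)
    with that have "y \<in> U" "y \<in> elts X" "y \<notin> a ` {..<n}" by auto
    with y fixed show ?thesis by simp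
  qed
  moreover have "inj_on (\<sigma> \<circ> a) {..<n}"
    using inj by (simp add: inj_on_def)
  ultimately show ?thesis
    unfolding is_cycle_def using perm a step by (intro conjI exI [of _ "\<sigma> \<circ> a"]) auto
qed

end


section \<open>Reflections and rotations of a cyclically indexed family\<close>

text \<open>Only meaningful for an \<open>h\<close> that respects the fibres of \<open>\<alpha>\<close>.\<close>

definition reindex :: "('i \<Rightarrow> 'v) \<Rightarrow> ('i \<Rightarrow> 'i) \<Rightarrow> 'v \<Rightarrow> 'v" where
  "reindex \<alpha> h x = (if x \<in> range \<alpha> then \<alpha> (h (inv \<alpha> x)) else x)"

lemma reindex_outside [simp]: "x \<notin> range \<alpha> \<Longrightarrow> reindex \<alpha> h x = x"
  by (simp add: reindex_def)

text \<open>\<open>inv \<alpha>\<close> may choose an index other than i for the point \<alpha> i;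
  the hypothesis makes the result independent of that choice.\<close>

lemma reindex_apply:
  assumes "\<And>i j. \<alpha> i = \<alpha> j \<Longrightarrow> \<alpha> (h i) = \<alpha> (h j)"
  shows "reindex \<alpha> h (\<alpha> i) = \<alpha> (h i)"
  using assms [of "inv \<alpha> (\<alpha> i)" i] by (simp add: reindex_def f_inv_into_f)

text \<open>Indices run over all integers with period n, so that rotating is adding and reflecting
  is negating, with no case distinction at the ends of the cycle.\<close>

locale cyclic_family =
  fixes \<alpha> :: "int \<Rightarrow> 'v" and n :: nat
  assumes \<alpha>_eq_iff: "\<alpha> i = \<alpha> j \<longleftrightarrow> i mod int n = j mod int n"
begin

definition rotation :: "int \<Rightarrow> 'v \<Rightarrow> 'v" where
  "rotation k = reindex \<alpha> (\<lambda>i. i + k)"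

definition reflection :: "'v \<Rightarrow> 'v" where
  "reflection = reindex \<alpha> uminus"

lemma rotation_\<alpha> [simp]: "rotation k (\<alpha> i) = \<alpha> (i + k)"
  unfolding rotation_def by (rule reindex_apply) (auto simp: \<alpha>_eq_iff intro: mod_add_cong)

lemma reflection_\<alpha> [simp]: "reflection (\<alpha> i) = \<alpha> (- i)"
  unfolding reflection_def by (rule reindex_apply) (auto simp: \<alpha>_eq_iff intro: mod_minus_cong)

lemma rotation_outside [simp]: "x \<notin> range \<alpha> \<Longrightarrow> rotation k x = x"
  by (simp add: rotation_def)

lemma reflection_outside [simp]: "x \<notin> range \<alpha> \<Longrightarrow> reflection x = x"
  by (simp add: reflection_def)

lemma rotation_rotation: "rotation k (rotation l x) = rotation (k + l) x"
  by (cases "x \<in> range \<alpha>") (auto simp: algebra_simps)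

lemma rotation_0: "rotation 0 x = x"
  by (cases "x \<in> range \<alpha>") auto

lemma reflection_reflection [simp]: "reflection (reflection x) = x"
  by (cases "x \<in> range \<alpha>") auto

lemma rotation_permutes:
  assumes "range \<alpha> \<subseteq> S"
  shows "rotation k permutes S"
proof (rule bij_imp_permutes)
  have "rotation k x \<in> S" if "x \<in> S" for k x
    using assms that by (cases "x \<in> range \<alpha>") auto
  then show "bij_betw (rotation k) S S"
    by (intro bij_betw_byWitness [of _ "rotation (- k)"]) (auto simp: rotation_rotation rotation_0)
  show "rotation k x = x" if "x \<notin> S" for x
    using assms that by (intro rotation_outside) blast
qed

lemma reflection_permutes:
  assumes "range \<alpha> \<subseteq> S"
  shows "reflection permutes S"
proof (rule bij_imp_permutes)
  have "reflection x \<in> S" if "x \<in> S" for x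
    using assms that by (cases "x \<in> range \<alpha>") auto
  then show "bij_betw (reflection) S S"
    by (intro bij_betw_byWitness [of _ "reflection"]) (auto)
  show "reflection x = x" if "x \<notin> S" for x
    using assms that by (intro reflection_outside) blast
qed

text \<open>The rotation that imitates the reflection depends on the pair, which is harmless for a
  binary relation. Symmetry of \<open>R\<close> is essential: the relation "y follows x on the
  cycle" is invariant under rotations but, for n \<ge> 3, not under the reflection.\<close>

lemma reflection_invariant:
  assumes rot: "\<And>k x y. R x y \<Longrightarrow> R (rotation k x) (rotation k y)"
    and sym: "\<And>x y. R x y \<Longrightarrow> R y x"
    and "R x y"
  shows "R (reflection x) (reflection y)"
proof -
  consider (none) "x \<notin> range \<alpha>" "y \<notin> range \<alpha>"
    | (left) i where "x = \<alpha> i" "y \<notin> range \<alpha>"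
    | (right) j where "x \<notin> range \<alpha>" "y = \<alpha> j"
    | (both) i j where "x = \<alpha> i" "y = \<alpha> j"
    by blast
  then show ?thesis
  proof cases
    case none
    then show ?thesis using \<open>R x y\<close> by simp
  next
    case left
    \<comment> \<open>Index i becomes i - 2i = -i, while y, lying off the cycle, stays in
      place.\<close>
    then show ?thesis using rot [OF \<open>R x y\<close>, of "- 2 * i"] by simp
  next
    case right
    then show ?thesis using rot [OF \<open>R x y\<close>, of "- 2 * j"] by simp
  next
    case both
    \<comment> \<open>Indices i and j become -j and -i: the rotation yields the reflected pair in
      swapped order.\<close>
    then show ?thesis using sym [OF rot [OF \<open>R x y\<close>, of "- i - j"]] by simp
  qed
qed

end


section \<open>The action of permutations of the atoms\<close>

context zfa_universe
begin

lemma set_of_eq: "x \<notin> Atoms \<Longrightarrow> elts x = X \<Longrightarrow> set_of X = x"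
  unfolding set_of_def using extensionality by (intro the_equality) auto

lemma
  assumes "\<exists>z. z \<notin> Atoms \<and> elts z = X"
  shows set_of_not_atom: "set_of X \<notin> Atoms" and elts_set_of: "elts (set_of X) = X"
  using assms set_of_eq by auto

lemma perm_ext_atom [simp]: "x \<in> Atoms \<Longrightarrow> perm_ext \<pi> x = \<pi> x"
  by (simp add: perm_ext.simps)

lemma
  assumes "x \<notin> Atoms"
  shows perm_ext_not_atom: "perm_ext \<pi> x \<notin> Atoms"
    and elts_perm_ext_set: "elts (perm_ext \<pi> x) = perm_ext \<pi> ` elts x"
  using assms set_of_not_atom [OF replacement] elts_set_of [OF replacement]
  by (simp_all add: perm_ext.simps [of \<pi> x])

lemma perm_ext_in_Atoms [simp]:
  "\<pi> permutes Atoms \<Longrightarrow> perm_ext \<pi> x \<in> Atoms \<longleftrightarrow> x \<in> Atoms"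
  by (metis perm_ext_atom perm_ext_not_atom permutes_in_image)

text \<open>Covers atoms too: they go to atoms, so both sides are empty.\<close>

lemma elts_perm_ext: "\<pi> permutes Atoms \<Longrightarrow> elts (perm_ext \<pi> x) = perm_ext \<pi> ` elts x"
  by (metis atoms_no_members elts_perm_ext_set image_empty perm_ext_in_Atoms)

lemma elts_induct [case_names step]:
  assumes "\<And>x. (\<And>y. y \<in> elts x \<Longrightarrow> Q y) \<Longrightarrow> Q x"
  shows "Q x"
  using foundation by (induction x rule: wf_induct_rule) (use assms in auto)

text \<open>Makes \<open>perm_ext\<close> a group action. For a set x, membership induction shows
  that both sides are sets with the same members.\<close>

lemma perm_ext_comp:
  assumes "\<pi> permutes Atoms" "\<rho> permutes Atoms"
  shows "perm_ext \<pi> (perm_ext \<rho> x) = perm_ext (\<pi> \<circ> \<rho>) x"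
proof (induction x rule: elts_induct)
  case (step x)
  show ?case
  proof (cases "x \<in> Atoms")
    case True
    then show ?thesis using assms by (simp add: permutes_in_image)
  next
    case False
    have "elts (perm_ext \<pi> (perm_ext \<rho> x)) = elts (perm_ext (\<pi> \<circ> \<rho>) x)"
      using assms step False
      by (simp add: elts_perm_ext elts_perm_ext_set [of x] image_image del: o_apply cong: image_cong)
    then show ?thesis
      using False by (intro extensionality perm_ext_not_atom)
  qed
qed

lemma perm_ext_id [simp]: "perm_ext id x = x"
proof (induction x rule: elts_induct)
  case (step x)
  show ?case
  proof (cases "x \<in> Atoms")
    case False
    then show ?thesis
      using step by (intro extensionality) (simp_all add: perm_ext_not_atom elts_perm_ext_set)
  qed simp
qed

lemma perm_ext_inv:
  assumes "\<pi> permutes Atoms"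
  shows "perm_ext (inv \<pi>) (perm_ext \<pi> x) = x" "perm_ext \<pi> (perm_ext (inv \<pi>) x) = x"
  using assms permutes_inv [OF assms] by (simp_all add: perm_ext_comp permutes_inv_o)

lemma bij_perm_ext: "\<pi> permutes Atoms \<Longrightarrow> bij (perm_ext \<pi>)"
  by (rule o_bij [of "perm_ext (inv \<pi>)"]) (simp_all add: fun_eq_iff perm_ext_inv)

text \<open>If \<rho> fixes the image of E pointwise, then its conjugate
  \<open>inv \<pi> \<circ> (\<rho> \<circ> \<pi>)\<close> fixes E pointwise and hence fixes
  x.\<close>

lemma supports_perm_ext:
  assumes "\<pi> permutes Atoms" "supports E x"
  shows "supports (\<pi> ` E) (perm_ext \<pi> x)"
  unfolding supports_def
proof (intro allI impI, elim conjE)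
  fix \<rho> assume \<rho>: "\<rho> permutes Atoms" "\<forall>a \<in> \<pi> ` E. \<rho> a = a"
  have inv: "inv \<pi> permutes Atoms" using assms(1) by (rule permutes_inv)
  have "inv \<pi> \<circ> (\<rho> \<circ> \<pi>) permutes Atoms"
    using assms(1) \<rho>(1) inv by (intro permutes_compose)
  moreover have "\<forall>a \<in> E. (inv \<pi> \<circ> (\<rho> \<circ> \<pi>)) a = a"
    using \<rho>(2) assms(1) by (simp add: permutes_inverses)
  ultimately have "perm_ext (inv \<pi> \<circ> (\<rho> \<circ> \<pi>)) x = x"
    using assms(2) unfolding supports_def by blast
  then have "perm_ext (inv \<pi>) (perm_ext \<rho> (perm_ext \<pi> x)) = x"
    using assms(1) \<rho>(1) inv by (simp add: perm_ext_comp permutes_compose)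
  then show "perm_ext \<rho> (perm_ext \<pi> x) = perm_ext \<pi> x"
    by (metis perm_ext_inv(2) assms(1))
qed

section \<open>Membership in the Fraenkel model\<close>

lemma symmetric_perm_ext:
  assumes "\<pi> permutes Atoms" "symmetric x"
  shows "symmetric (perm_ext \<pi> x)"
proof -
  obtain E where "finite E" "E \<subseteq> Atoms" "supports E x"
    using assms(2) unfolding symmetric_def by blast
  then show ?thesis
    unfolding symmetric_def using assms(1) supports_perm_ext permutes_in_image [OF assms(1)]
    by (intro exI [of _ "\<pi> ` E"]) auto
qed

text \<open>Hereditary symmetry unfolded by one membership step, the form suited to membership
  induction and to checking a single set.\<close>

lemma fraenkel_model_iff: "x \<in> fraenkel_model \<longleftrightarrow> symmetric x \<and> elts x \<subseteq> fraenkel_model"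
proof
  assume x: "x \<in> fraenkel_model"
  then have "symmetric x" unfolding fraenkel_model_def by blast
  with x show "symmetric x \<and> elts x \<subseteq> fraenkel_model"
    using fraenkel_model_transitive by blast
next
  assume x: "symmetric x \<and> elts x \<subseteq> fraenkel_model"
  \<comment> \<open>A membership chain from y up to x is either trivial or passes last through a
    member z of x, whose own hereditary symmetry covers y.\<close>
  have "symmetric y" if "(y, x) \<in> {(u, v). u \<in> elts v}\<^sup>*" for y
    using that
  proof (cases rule: rtranclE)
    case base
    then show ?thesis using x by simp
  next
    case (step z)
    then show ?thesis using x unfolding fraenkel_model_def by blast
  qed
  then show "x \<in> fraenkel_model" unfolding fraenkel_model_def by blast
qed

lemma perm_ext_in_fraenkel_model:
  assumes "\<pi> permutes Atoms"
  shows "x \<in> fraenkel_model \<Longrightarrow> perm_ext \<pi> x \<in> fraenkel_model"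
proof (induction x rule: elts_induct)
  case (step x)
  then show ?case
    using assms fraenkel_model_iff [of x] fraenkel_model_iff [of "perm_ext \<pi> x"]
    by (auto simp: elts_perm_ext symmetric_perm_ext)
qed

lemma perm_ext_automorphism:
  assumes "\<pi> permutes Atoms"
  shows "zfa_automorphism fraenkel_model elts Atoms (perm_ext \<pi>)"
proof
  show "perm_ext \<pi> x \<in> fraenkel_model \<longleftrightarrow> x \<in> fraenkel_model" for x
    by (metis assms perm_ext_in_fraenkel_model perm_ext_inv(1) permutes_inv)
qed (use assms in \<open>simp_all add: bij_perm_ext elts_perm_ext\<close>)

lemma atom_in_fraenkel_model:
  assumes "a \<in> Atoms"
  shows "a \<in> fraenkel_model"
proof -
  have "supports {a} a" using assms by (simp add: supports_def)
  then have "symmetric a" unfolding symmetric_def using assms by blast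
  then show ?thesis using assms by (subst fraenkel_model_iff) (simp add: atoms_no_members)
qed

text \<open>Such a set has empty support: closure under \<pi> and under its inverse turns the
  inclusion between the sets of members into equality.\<close>

lemma in_fraenkel_model_if_invariant:
  assumes "x \<notin> Atoms" "elts x \<subseteq> fraenkel_model"
    and "\<And>\<pi> y. \<pi> permutes Atoms \<Longrightarrow> y \<in> elts x \<Longrightarrow> perm_ext \<pi> y \<in> elts x"
  shows "x \<in> fraenkel_model"
proof -
  have "perm_ext \<pi> x = x" if "\<pi> permutes Atoms" for \<pi>
  proof (rule extensionality)
    have "y \<in> perm_ext \<pi> ` elts x" if "y \<in> elts x" for y
      using assms(3) [OF permutes_inv [OF \<open>\<pi> permutes Atoms\<close>] that] perm_ext_inv(2)
        \<open>\<pi> permutes Atoms\<close> by (metis image_eqI)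
    then show "elts (perm_ext \<pi> x) = elts x"
      using assms(3) that by (auto simp: elts_perm_ext)
  qed (use assms(1) that in auto)
  then have "supports {} x" by (simp add: supports_def)
  then have "symmetric x" unfolding symmetric_def by blast
  with assms(2) show ?thesis by (subst fraenkel_model_iff) simp
qed


section \<open>Ordered pairs and graphs\<close>

interpretation F: zfa_structure fraenkel_model elts Atoms .

definition upair :: "'v \<Rightarrow> 'v \<Rightarrow> 'v" where
  "upair x y = set_of {x, y}"

definition opair :: "'v \<Rightarrow> 'v \<Rightarrow> 'v" where
  "opair x y = upair (upair x x) (upair x y)"

lemma upair_not_atom [simp]: "upair x y \<notin> Atoms"
  and elts_upair [simp]: "elts (upair x y) = {x, y}"
  unfolding upair_def using pairing by (rule set_of_not_atom elts_set_of)+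

lemma upair_eq_iff: "upair x y = upair x' y' \<longleftrightarrow> {x, y} = {x', y'}"
  by (metis elts_upair upair_def)

lemma opair_eq_iff [simp]: "opair x y = opair x' y' \<longleftrightarrow> x = x' \<and> y = y'"
  by (auto simp: opair_def upair_eq_iff doubleton_eq_iff)

lemma perm_ext_upair: "perm_ext \<pi> (upair x y) = upair (perm_ext \<pi> x) (perm_ext \<pi> y)"
  by (rule extensionality) (simp_all add: perm_ext_not_atom elts_perm_ext_set)

lemma perm_ext_opair: "perm_ext \<pi> (opair x y) = opair (perm_ext \<pi> x) (perm_ext \<pi> y)"
  by (simp add: opair_def perm_ext_upair)

text \<open>The union of a support of x and a support of y supports the pair.\<close>

lemma upair_in_fraenkel_model:
  assumes "x \<in> fraenkel_model" "y \<in> fraenkel_model"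
  shows "upair x y \<in> fraenkel_model"
proof -
  obtain E E' where "finite E" "E \<subseteq> Atoms" "supports E x" "finite E'" "E' \<subseteq> Atoms" "supports E' y"
    using assms fraenkel_model_iff unfolding symmetric_def by meson
  then have "symmetric (upair x y)"
    unfolding symmetric_def
    by (intro exI [of _ "E \<union> E'"]) (auto simp: supports_def perm_ext_upair)
  then show ?thesis using assms by (subst fraenkel_model_iff) simp
qed

lemma opair_in_fraenkel_model:
  "x \<in> fraenkel_model \<Longrightarrow> y \<in> fraenkel_model \<Longrightarrow> opair x y \<in> fraenkel_model"
  by (simp add: opair_def upair_in_fraenkel_model)

text \<open>Absoluteness of pairing: the model is transitive and closed under pairs, so what it
  takes for a pair is the actual pair.\<close>

lemma is_upair_iff_upair:
  assumes "x \<in> fraenkel_model" "y \<in> fraenkel_model"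
  shows "F.is_upair x y z \<longleftrightarrow> z = upair x y"
proof
  assume z: "F.is_upair x y z"
  then have "elts z = {x, y}"
    using assms fraenkel_model_transitive unfolding F.is_upair_def F.is_set_def by blast
  with z show "z = upair x y"
    by (intro extensionality) (simp_all add: F.is_upair_def F.is_set_def)
qed (use assms in \<open>simp add: F.is_upair_def F.is_set_def upair_in_fraenkel_model\<close>)

lemma is_opair_iff_opair:
  assumes "x \<in> fraenkel_model" "y \<in> fraenkel_model"
  shows "F.is_opair x y p \<longleftrightarrow> p = opair x y"
  using assms
  by (auto simp: F.is_opair_def is_upair_iff_upair upair_in_fraenkel_model opair_def)

lemma is_function_elts:
  assumes "f \<in> fraenkel_model" "F.is_function f X Y" "p \<in> elts f"
  obtains x y where "x \<in> elts X" "y \<in> elts Y" "p = opair x y"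
proof -
  have "p \<in> fraenkel_model" using assms(1,3) by (rule fraenkel_model_transitive)
  then obtain x y where xy: "x \<in> fraenkel_model" "y \<in> fraenkel_model" "x \<in> elts X" "y \<in> elts Y"
    "F.is_opair x y p"
    using assms(2,3) unfolding F.is_function_def by blast
  then have "p = opair x y" by (simp add: is_opair_iff_opair)
  with xy show thesis using that by blast
qed

lemma maps_to_iff_opair:
  assumes "f \<in> fraenkel_model" "x \<in> fraenkel_model" "y \<in> fraenkel_model"
  shows "F.maps_to f x y \<longleftrightarrow> opair x y \<in> elts f"
  using assms fraenkel_model_transitive
  by (auto simp: F.maps_to_def is_opair_iff_opair)

section \<open>Graphs of permutations of the atoms\<close>

definition graph :: "('v \<Rightarrow> 'v) \<Rightarrow> 'v" where
  "graph c = set_of ((\<lambda>x. opair x (c x)) ` Atoms)"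

lemma graph_not_atom [simp]: "graph c \<notin> Atoms"
  and elts_graph: "elts (graph c) = (\<lambda>x. opair x (c x)) ` Atoms"
proof -
  have "\<exists>z. z \<notin> Atoms \<and> elts z = (\<lambda>x. opair x (c x)) ` Atoms"
    using set_of_atoms replacement by metis
  then show "graph c \<notin> Atoms" "elts (graph c) = (\<lambda>x. opair x (c x)) ` Atoms"
    unfolding graph_def by (rule set_of_not_atom elts_set_of)+
qed

lemma opair_in_graph [simp]: "opair x y \<in> elts (graph c) \<longleftrightarrow> x \<in> Atoms \<and> y = c x"
  by (auto simp: elts_graph)

text \<open>\<pi> sends the pair (x, c x) to (\<pi> x, c (\<pi> x)), again a pair of the graph, and
  \<pi> x runs through all atoms as x does.\<close>

lemma perm_ext_graph:
  assumes \<pi>: "\<pi> permutes Atoms" and c: "c permutes Atoms"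
    and comm: "\<And>x. x \<in> Atoms \<Longrightarrow> \<pi> (c x) = c (\<pi> x)"
  shows "perm_ext \<pi> (graph c) = graph c"
proof (rule extensionality)
  have "perm_ext \<pi> ` elts (graph c) = (\<lambda>x. opair (\<pi> x) (c (\<pi> x))) ` Atoms"
    unfolding elts_graph image_image
    by (rule image_cong) (simp_all add: perm_ext_opair comm permutes_in_image [OF c])
  also have "\<dots> = (\<lambda>x. opair x (c x)) ` \<pi> ` Atoms"
    by (simp add: image_image)
  also have "\<dots> = elts (graph c)"
    by (simp add: elts_graph permutes_image [OF \<pi>])
  finally show "elts (perm_ext \<pi> (graph c)) = elts (graph c)"
    using \<pi> by (simp add: elts_perm_ext)
qed (simp_all add: perm_ext_not_atom)

text \<open>S supports the graph, because a permutation fixing S pointwise commutes with c, which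
  moves points only within S.\<close>

lemma graph_in_fraenkel_model:
  assumes c: "c permutes Atoms" and S: "finite S" "S \<subseteq> Atoms"
    and supp: "\<And>x. x \<in> S \<Longrightarrow> c x \<in> S" "\<And>x. x \<notin> S \<Longrightarrow> c x = x"
  shows "graph c \<in> fraenkel_model"
proof -
  have "perm_ext \<pi> (graph c) = graph c" if \<pi>: "\<pi> permutes Atoms" "\<forall>a \<in> S. \<pi> a = a" for \<pi>
  proof (rule perm_ext_graph [OF \<pi>(1) c])
    fix x
    show "\<pi> (c x) = c (\<pi> x)"
    proof (cases "x \<in> S")
      case True
      then show ?thesis using \<pi>(2) supp(1) by simp
    next
      case False
      \<comment> \<open>By injectivity: \<pi> x in S would be a fixed point of \<pi>, forcing \<pi>
        x = x.\<close>
      then have "\<pi> x \<notin> S" using \<pi> by (metis permutes_def)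
      then show ?thesis using False supp(2) by simp
    qed
  qed
  then have "symmetric (graph c)" unfolding symmetric_def supports_def using S by blast
  moreover have "elts (graph c) \<subseteq> fraenkel_model"
    unfolding elts_graph
    by (intro image_subsetI opair_in_fraenkel_model atom_in_fraenkel_model)
      (simp_all add: permutes_in_image [OF c])
  ultimately show ?thesis by (subst fraenkel_model_iff) simp
qed

lemma is_permutation_graph:
  assumes c: "c permutes Atoms" and G: "graph c \<in> fraenkel_model" and A: "elts A = Atoms"
  shows "F.is_permutation (graph c) A"
proof -
  have maps: "F.maps_to (graph c) x y \<longleftrightarrow> x \<in> Atoms \<and> y = c x"
    if "x \<in> fraenkel_model" "y \<in> fraenkel_model" for x y
    using G that by (simp add: maps_to_iff_opair)
  have cA: "c x \<in> Atoms \<longleftrightarrow> x \<in> Atoms" for x by (rule permutes_in_image [OF c])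
  have "F.is_function (graph c) A A"
    unfolding F.is_function_def
  proof (intro conjI ballI impI)
    show "F.is_set (graph c)" using G by (simp add: F.is_set_def)
  next
    fix p assume "p \<in> elts (graph c)"
    then obtain x where "x \<in> Atoms" "p = opair x (c x)" by (auto simp: elts_graph)
    then show "\<exists>x \<in> fraenkel_model. \<exists>y \<in> fraenkel_model.
        x \<in> elts A \<and> y \<in> elts A \<and> F.is_opair x y p"
      using A cA by (intro bexI [of _ x] bexI [of _ "c x"])
        (simp_all add: is_opair_iff_opair atom_in_fraenkel_model)
  next
    fix x assume "x \<in> fraenkel_model" "x \<in> elts A"
    then show "\<exists>!y. y \<in> fraenkel_model \<and> F.maps_to (graph c) x y"
      using A cA maps atom_in_fraenkel_model by (intro ex1I [of _ "c x"]) auto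
  qed
  moreover have "x = x'" if "c x = c x'" for x x'
    using that permutes_inj [OF c] by (simp add: inj_eq)
  ultimately have "F.is_injection (graph c) A A"
    unfolding F.is_injection_def using maps by auto
  moreover have "\<exists>x \<in> fraenkel_model. F.maps_to (graph c) x y" if "y \<in> Atoms" for y
  proof (rule bexI)
    show "inv c y \<in> fraenkel_model"
      using that permutes_in_image [OF permutes_inv [OF c]] atom_in_fraenkel_model by blast
    then show "F.maps_to (graph c) (inv c y) y"
      using that maps permutes_in_image [OF permutes_inv [OF c]] atom_in_fraenkel_model
      by (simp add: permutes_inverses [OF c])
  qed
  ultimately show ?thesis unfolding F.is_permutation_def using A by simp
qed


section \<open>The sets of cycles and of partitions\<close>

lemma obtain_atom_set:
  obtains A where "A \<in> fraenkel_model" "A \<notin> Atoms" "elts A = Atoms" "F.is_atom_set A"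
proof -
  obtain A where A: "A \<notin> Atoms" "elts A = Atoms" using set_of_atoms by blast
  have "A \<in> fraenkel_model"
    by (intro in_fraenkel_model_if_invariant)
      (simp_all add: A subsetI atom_in_fraenkel_model permutes_in_image)
  moreover from this A have "F.is_atom_set A" unfolding F.is_atom_set_def F.is_set_def by blast
  ultimately show thesis using A that by blast
qed

lemma perm_ext_atom_set:
  assumes "\<pi> permutes Atoms" "A \<notin> Atoms" "elts A = Atoms"
  shows "perm_ext \<pi> A = A"
  using assms permutes_image [OF assms(1)]
  by (intro extensionality) (simp_all add: elts_perm_ext_set perm_ext_not_atom)

text \<open>Comprehension for the model: separation is carried out in V inside the bound B, and
  invariance of Q under all permutations gives the result empty support.\<close>

lemma obtain_invariant_set:
  assumes bound: "\<And>x. x \<in> fraenkel_model \<Longrightarrow> Q x \<Longrightarrow> x \<in> elts B"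
    and inv: "\<And>\<pi> x. \<pi> permutes Atoms \<Longrightarrow> Q x \<Longrightarrow> Q (perm_ext \<pi> x)"
  obtains S where "S \<in> fraenkel_model" "F.is_set S"
    "\<And>x. x \<in> elts S \<longleftrightarrow> x \<in> fraenkel_model \<and> Q x"
proof -
  obtain S where S: "S \<notin> Atoms" "elts S = {x \<in> elts B. x \<in> fraenkel_model \<and> Q x}"
    using separation [of B "\<lambda>x. x \<in> fraenkel_model \<and> Q x"] by blast
  then have eq: "x \<in> elts S \<longleftrightarrow> x \<in> fraenkel_model \<and> Q x" for x using bound by auto
  then have "S \<in> fraenkel_model"
    using S(1) inv perm_ext_in_fraenkel_model by (intro in_fraenkel_model_if_invariant) auto
  then show thesis using that S(1) eq by (simp add: F.is_set_def)
qed

lemma obtain_power_set: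
  obtains z where "\<And>y. y \<in> elts z \<longleftrightarrow> y \<notin> Atoms \<and> elts y \<subseteq> elts x"
  using power_set [of x] by blast

lemma obtain_Cycles:
  assumes A: "A \<notin> Atoms" "elts A = Atoms"
  obtains C where "C \<in> fraenkel_model" "F.is_Cycles n A C"
proof -
  \<comment> \<open>The bounds are power sets taken in V: Kuratowski pairs of atoms lie in the
    second power set of A, sets of such pairs in the third.\<close>
  obtain A1 where A1: "\<And>y. y \<in> elts A1 \<longleftrightarrow> y \<notin> Atoms \<and> elts y \<subseteq> elts A"
    using obtain_power_set by blast
  obtain A2 where A2: "\<And>y. y \<in> elts A2 \<longleftrightarrow> y \<notin> Atoms \<and> elts y \<subseteq> elts A1"
    using obtain_power_set by blast
  obtain A3 where A3: "\<And>y. y \<in> elts A3 \<longleftrightarrow> y \<notin> Atoms \<and> elts y \<subseteq> elts A2"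
    using obtain_power_set by blast
  have bound: "g \<in> elts A3" if g: "g \<in> fraenkel_model" "F.is_cycle n g A" for g
  proof -
    have fn: "F.is_function g A A"
      using g unfolding F.is_cycle_def F.is_permutation_def F.is_injection_def by blast
    have "p \<in> elts A2" if "p \<in> elts g" for p
    proof -
      obtain x y where "x \<in> elts A" "y \<in> elts A" "p = opair x y"
        using g(1) fn \<open>p \<in> elts g\<close> by (rule is_function_elts)
      then show ?thesis by (simp add: A1 A2 opair_def)
    qed
    moreover have "g \<notin> Atoms" using fn unfolding F.is_function_def F.is_set_def by blast
    ultimately show ?thesis unfolding A3 by blast
  qed
  have inv: "F.is_cycle n (perm_ext \<pi> g) A" if "\<pi> permutes Atoms" "F.is_cycle n g A" for \<pi> g
    using zfa_automorphism.is_cycle_image [OF perm_ext_automorphism [OF that(1)] that(2)]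
      perm_ext_atom_set [OF that(1) A] by simp
  obtain C where "C \<in> fraenkel_model" "F.is_set C"
    "\<And>g. g \<in> elts C \<longleftrightarrow> g \<in> fraenkel_model \<and> F.is_cycle n g A"
    using obtain_invariant_set [of "\<lambda>g. F.is_cycle n g A", OF bound inv] by blast
  then show thesis using that [of C] by (simp add: F.is_Cycles_def)
qed

lemma obtain_Part:
  assumes A: "A \<notin> Atoms" "elts A = Atoms"
  obtains P where "P \<in> fraenkel_model" "F.is_Part A P"
proof -
  obtain A1 where A1: "\<And>y. y \<in> elts A1 \<longleftrightarrow> y \<notin> Atoms \<and> elts y \<subseteq> elts A"
    using obtain_power_set by blast
  obtain A2 where A2: "\<And>y. y \<in> elts A2 \<longleftrightarrow> y \<notin> Atoms \<and> elts y \<subseteq> elts A1"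
    using obtain_power_set by blast
  have bound: "p \<in> elts A2" if p: "p \<in> fraenkel_model" "F.is_partition p A" for p
  proof -
    have "b \<in> elts A1" if "b \<in> elts p" for b
    proof -
      \<comment> \<open>\<open>is_partition\<close> constrains only members lying in the model;
        transitivity extends this to all members of b.\<close>
      have "b \<in> fraenkel_model" using p(1) that by (rule fraenkel_model_transitive)
      then show ?thesis
        using p(2) that fraenkel_model_transitive [of b]
        unfolding A1 F.is_partition_def F.is_set_def by blast
    qed
    moreover have "p \<notin> Atoms" using p(2) unfolding F.is_partition_def F.is_set_def by blast
    ultimately show ?thesis unfolding A2 by blast
  qed
  have inv: "F.is_partition (perm_ext \<pi> p) A" if "\<pi> permutes Atoms" "F.is_partition p A" for \<pi> p
    using zfa_automorphism.is_partition_iff [OF perm_ext_automorphism [OF that(1)], of p A] that(2)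
      perm_ext_atom_set [OF that(1) A] by simp
  obtain P where "P \<in> fraenkel_model" "F.is_set P"
    "\<And>p. p \<in> elts P \<longleftrightarrow> p \<in> fraenkel_model \<and> F.is_partition p A"
    using obtain_invariant_set [of "\<lambda>p. F.is_partition p A", OF bound inv] by blast
  then show thesis using that [of P] by (simp add: F.is_Part_def)
qed

section \<open>Partitions and their equivalence relations\<close>

definition same_block :: "'v \<Rightarrow> 'v \<Rightarrow> 'v \<Rightarrow> bool" where
  "same_block p x y \<longleftrightarrow> (\<exists>b \<in> elts p. x \<in> elts b \<and> y \<in> elts b)"

lemma same_block_perm_ext:
  assumes "\<pi> permutes Atoms" "same_block p x y"
  shows "same_block (perm_ext \<pi> p) (perm_ext \<pi> x) (perm_ext \<pi> y)"
  using assms unfolding same_block_def by (auto simp: elts_perm_ext)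

text \<open>A partition is determined by its equivalence relation, so invariance of p reduces to
  that of a symmetric binary relation, the setting of \<open>reflection_invariant\<close>.\<close>

lemma perm_ext_partition:
  assumes \<pi>: "\<pi> permutes Atoms" and p: "p \<in> fraenkel_model" "F.is_partition p A"
    and A: "elts A = Atoms"
    and same: "\<And>x y. x \<in> Atoms \<Longrightarrow> y \<in> Atoms \<Longrightarrow> same_block p (\<pi> x) (\<pi> y) \<longleftrightarrow> same_block p x y"
  shows "perm_ext \<pi> p = p"
proof -
  have pU: "b \<in> fraenkel_model" if "b \<in> elts p" for b
    using fraenkel_model_transitive [OF p(1) that] .
  have bU: "x \<in> fraenkel_model" if "b \<in> elts p" "x \<in> elts b" for b x
    using fraenkel_model_transitive [OF pU [OF that(1)] that(2)] .
  have set: "b \<notin> Atoms" and nonempty: "\<exists>x. x \<in> elts b" if "b \<in> elts p" for b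
    using p(2) pU that unfolding F.is_partition_def F.is_set_def by blast+
  have disjoint: "b = b'" if "b \<in> elts p" "b' \<in> elts p" "x \<in> elts b" "x \<in> elts b'" for b b' x
    using p(2) pU bU that unfolding F.is_partition_def by blast
  have cover: "x \<in> Atoms \<longleftrightarrow> (\<exists>b \<in> elts p. x \<in> elts b)" for x
    using p(2) pU bU A atom_in_fraenkel_model unfolding F.is_partition_def by metis
  \<comment> \<open>The block of x is carried onto the block of \<pi> x. One inclusion uses that
    \<pi> preserves the relation, the other that it reflects it.\<close>
  have image: "perm_ext \<pi> b = b'"
    if b: "b \<in> elts p" "x \<in> elts b" and b': "b' \<in> elts p" "\<pi> x \<in> elts b'" for b b' x
  proof (rule extensionality)
    have atom: "x \<in> Atoms" "y \<in> elts b \<Longrightarrow> y \<in> Atoms" "z \<in> elts b' \<Longrightarrow> z \<in> Atoms" for y z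
      using cover b b' by blast+
    have "\<pi> y \<in> elts b'" if "y \<in> elts b" for y
    proof -
      have "same_block p (\<pi> x) (\<pi> y)"
        using same atom that b unfolding same_block_def by blast
      then show ?thesis using disjoint b' unfolding same_block_def by blast
    qed
    moreover have "z \<in> \<pi> ` elts b" if z: "z \<in> elts b'" for z
    proof -
      obtain y where y: "y \<in> Atoms" "z = \<pi> y"
        using atom(3) [OF z] permutes_image [OF \<pi>] by blast
      then have "same_block p x y"
        using same atom(1) z b' unfolding same_block_def by blast
      then have "y \<in> elts b" using disjoint b unfolding same_block_def by blast
      with y show ?thesis by blast
    qed
    moreover have "perm_ext \<pi> ` elts b = \<pi> ` elts b" using atom(2) by (intro image_cong) auto
    ultimately show "elts (perm_ext \<pi> b) = elts b'" using \<pi> by (auto simp: elts_perm_ext)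
  qed (use set b b' \<pi> in auto)
  have "perm_ext \<pi> ` elts p = elts p"
  proof (intro equalityI subsetI)
    fix b' assume "b' \<in> perm_ext \<pi> ` elts p"
    \<comment> \<open>A point x of b determines the image: some block contains \<pi> x by
      \<open>cover\<close>, and \<open>image\<close> identifies it with b'.\<close>
    then obtain b x where b: "b \<in> elts p" "b' = perm_ext \<pi> b" "x \<in> elts b" using nonempty by blast
    then have "\<pi> x \<in> Atoms" using cover permutes_in_image [OF \<pi>] by blast
    then show "b' \<in> elts p" using cover image b by blast
  next
    fix b' assume b': "b' \<in> elts p"
    then obtain x' where x': "x' \<in> elts b'" using nonempty by blast
    then obtain x where "x \<in> Atoms" "x' = \<pi> x"
      using b' cover permutes_image [OF \<pi>] by blast
    then show "b' \<in> perm_ext \<pi> ` elts p" using cover image b' x' by blast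
  qed
  moreover have "p \<notin> Atoms" using p(2) by (simp add: F.is_partition_def F.is_set_def)
  ultimately show ?thesis using \<pi> by (intro extensionality) (auto simp: elts_perm_ext)
qed


section \<open>No injection from cycles to partitions\<close>

lemma obtain_cyclic_family:
  assumes "infinite Atoms" "finite E" "0 < n"
  obtains \<alpha> where "cyclic_family \<alpha> n" "range \<alpha> \<subseteq> Atoms - E"
proof -
  have "infinite (Atoms - E)" using assms by simp
  then obtain e :: "nat \<Rightarrow> 'v" where e: "inj e" "range e \<subseteq> Atoms - E"
    using infinite_countable_subset by blast
  \<comment> \<open>Index i is reduced to its remainder in 0, ..., n - 1, which selects one of the
    first n atoms of the injective sequence.\<close>
  define \<alpha> where "\<alpha> = (\<lambda>i. e (nat (i mod int n)))"
  have "cyclic_family \<alpha> n"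
    by standard (use e(1) \<open>0 < n\<close> in \<open>auto simp: \<alpha>_def inj_eq nat_eq_iff\<close>)
  moreover have "range \<alpha> \<subseteq> Atoms - E" using e(2) by (auto simp: \<alpha>_def)
  ultimately show thesis by (rule that)
qed

lemma is_cycle_graph_rotation:
  assumes "cyclic_family \<alpha> n" "range \<alpha> \<subseteq> Atoms" "0 < n" "elts A = Atoms"
  shows "graph (cyclic_family.rotation \<alpha> 1) \<in> fraenkel_model"
    and "F.is_cycle n (graph (cyclic_family.rotation \<alpha> 1)) A"
proof -
  interpret cyclic_family \<alpha> n by fact
  have perm: "rotation 1 permutes Atoms" using assms(2) by (rule rotation_permutes)
  \<comment> \<open>The remainders list the whole cycle; this gives finiteness of the support and
    identifies the points off the list as those fixed by the rotation.\<close>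
  have range: "range \<alpha> = (\<lambda>i. \<alpha> (int i)) ` {..<n}"
  proof -
    have "\<alpha> i = \<alpha> (int (nat (i mod int n)))" "nat (i mod int n) < n" for i
      using \<open>0 < n\<close> by (simp_all add: \<alpha>_eq_iff nat_less_iff)
    then show ?thesis by blast
  qed
  show G: "graph (rotation 1) \<in> fraenkel_model"
  proof (rule graph_in_fraenkel_model [OF perm, of "range \<alpha>"])
    show "finite (range \<alpha>)" by (simp add: range)
  qed (use assms(2) in auto)
  have atom: "\<alpha> i \<in> Atoms" for i using assms(2) by blast
  have maps: "F.maps_to (graph (rotation 1)) x (rotation 1 x)" if "x \<in> Atoms" for x
    using that G permutes_in_image [OF perm]
    by (simp add: maps_to_iff_opair atom_in_fraenkel_model)
  have "F.maps_to (graph (rotation 1)) (\<alpha> (int i)) (\<alpha> (int (Suc i mod n)))" for i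
  proof -
    \<comment> \<open>The wrap-around at i = n - 1 is absorbed by the periodicity of
      \<alpha>.\<close>
    have "\<alpha> (int (Suc i mod n)) = rotation 1 (\<alpha> (int i))"
      by (simp add: \<alpha>_eq_iff zmod_int add.commute)
    then show ?thesis using maps [OF atom] by metis
  qed
  moreover have "F.maps_to (graph (rotation 1)) x x"
    if "x \<in> Atoms" "x \<notin> (\<lambda>i. \<alpha> (int i)) ` {..<n}" for x
    using maps [OF that(1)] that(2) range by simp
  moreover have "inj_on (\<lambda>i. \<alpha> (int i)) {..<n}"
    by (auto simp: inj_on_def \<alpha>_eq_iff)
  ultimately show "F.is_cycle n (graph (rotation 1)) A"
    unfolding F.is_cycle_def using is_permutation_graph [OF perm G] assms(4) atom
    by (intro conjI exI [of _ "\<lambda>i. \<alpha> (int i)"]) (auto simp: atom_in_fraenkel_model)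
qed

lemma not_card_le_Cycles_Part:
  assumes "infinite Atoms" "3 \<le> n" and A: "elts A = Atoms"
    and C: "F.is_Cycles n A C" and P: "F.is_Part A P"
  shows "\<not> F.card_le C P"
proof
  assume "F.card_le C P"
  then obtain f where f: "f \<in> fraenkel_model" "F.is_injection f C P"
    unfolding F.card_le_def by blast
  then have fn: "F.is_function f C P" by (simp add: F.is_injection_def)
  obtain E where E: "finite E" "E \<subseteq> Atoms" "supports E f"
    using f(1) fraenkel_model_iff unfolding symmetric_def by blast
  obtain \<alpha> where \<alpha>: "cyclic_family \<alpha> n" "range \<alpha> \<subseteq> Atoms - E"
    using obtain_cyclic_family [of E n] assms E by auto
  then interpret cyclic_family \<alpha> n by simp
  have range: "range \<alpha> \<subseteq> Atoms" using \<alpha>(2) by blast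
  have rot: "rotation k permutes Atoms" for k using range by (rule rotation_permutes)
  have refl: "reflection permutes Atoms" using range by (rule reflection_permutes)
  define g where "g = graph (rotation 1)"
  have g: "g \<in> fraenkel_model" "F.is_cycle n g A"
    unfolding g_def using is_cycle_graph_rotation [OF \<alpha>(1) range _ A] assms(2) by simp_all
  then have "g \<in> elts C" using C by (simp add: F.is_Cycles_def)
  then obtain p where p: "p \<in> fraenkel_model" "F.maps_to f g p"
    and unique: "\<And>q. q \<in> fraenkel_model \<Longrightarrow> F.maps_to f g q \<Longrightarrow> q = p"
    using fn g(1) unfolding F.is_function_def by metis
  have "opair g p \<in> elts f" using f p g by (simp add: maps_to_iff_opair)
  with f(1) fn have "p \<in> elts P" by (metis is_function_elts opair_eq_iff)
  then have part: "F.is_partition p A" using P p(1) by (simp add: F.is_Part_def)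
  \<comment> \<open>\<pi> moves only points of the cycle, which avoids E, so it fixes f; applying it
    to "f maps g to p" changes only g and p.\<close>
  have equivariant: "F.maps_to f (perm_ext \<pi> g) (perm_ext \<pi> p)"
    if "\<pi> permutes Atoms" "\<And>x. x \<notin> range \<alpha> \<Longrightarrow> \<pi> x = x" for \<pi>
  proof -
    have "perm_ext \<pi> f = f" using E(3) that \<alpha>(2) unfolding supports_def by blast
    then show ?thesis
      using zfa_automorphism.maps_to_iff [OF perm_ext_automorphism [OF that(1)], of f g p] p(2)
      by simp
  qed
  \<comment> \<open>Rotations commute with \<open>rotation 1\<close> and so fix g; p and its rotated
    copy are then both values of f at g.\<close>
  have rot_p: "perm_ext (rotation k) p = p" for k
  proof (rule unique)
    show "perm_ext (rotation k) p \<in> fraenkel_model"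
      using rot p(1) by (rule perm_ext_in_fraenkel_model)
    have "perm_ext (rotation k) g = g"
      unfolding g_def using rot by (intro perm_ext_graph) (simp_all add: rotation_rotation add.commute)
    then show "F.maps_to f g (perm_ext (rotation k) p)"
      using equivariant [OF rot, of k] by simp
  qed
  have same_rot: "same_block p (rotation k x) (rotation k y)" if "same_block p x y" for k x y
  proof -
    \<comment> \<open>On atoms \<open>perm_ext (rotation k)\<close> reduces to
      \<open>rotation k\<close>.\<close>
    have "x \<in> Atoms" "y \<in> Atoms"
      using that part p(1) A fraenkel_model_transitive
      unfolding same_block_def F.is_partition_def by metis+
    then show ?thesis using same_block_perm_ext [OF rot that, of k] by (simp add: rot_p)
  qed
  have same_refl: "same_block p (reflection x) (reflection y)" if "same_block p x y" for x y
    by (rule reflection_invariant [of "same_block p", OF same_rot _ that])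
      (auto simp: same_block_def)
  have "perm_ext reflection p = p"
  proof (rule perm_ext_partition [OF refl p(1) part A])
    show "same_block p (reflection x) (reflection y) \<longleftrightarrow> same_block p x y" for x y
      \<comment> \<open>The reflection is an involution, so the second instance is the converse of
        the first.\<close>
      using same_refl [of x y] same_refl [of "reflection x" "reflection y"] by auto
  qed
  \<comment> \<open>f sends g and its reflected copy to the same partition, so injectivity makes
    them equal.\<close>
  then have "F.maps_to f (perm_ext reflection g) p"
    using equivariant [OF refl] by simp
  then have refl_g: "perm_ext reflection g = g"
    using f(2) p g(1) perm_ext_in_fraenkel_model [OF refl g(1)]
    unfolding F.is_injection_def by blast
  have atom: "\<alpha> i \<in> Atoms" for i using range by blast
  \<comment> \<open>The reflection fixes \<alpha> 0 and sends \<alpha> 1 to \<alpha> (- 1), so g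
    would map \<alpha> 0 to both. The indices 1 and -1 agree modulo n only if n divides 2.\<close>
  have "opair (\<alpha> 0) (\<alpha> 1) \<in> elts g" by (simp add: g_def atom)
  then have "perm_ext reflection (opair (\<alpha> 0) (\<alpha> 1)) \<in> elts (perm_ext reflection g)"
    using refl by (simp add: elts_perm_ext)
  then have "opair (\<alpha> 0) (\<alpha> (- 1)) \<in> elts g"
    by (simp add: refl_g perm_ext_opair atom)
  then have "\<alpha> (- 1) = \<alpha> 1" by (simp add: g_def)
  then have "int n dvd 2" by (simp add: \<alpha>_eq_iff mod_eq_dvd_iff)
  then show False using assms(2) zdvd_imp_le [of "int n" 2] by simp
qed

end

theorem theorem3p1:
  fixes elts :: "'v \<Rightarrow> 'v set" and Atoms :: "'v set" and n :: nat
  defines "VF0 \<equiv> zfa_universe.fraenkel_model elts Atoms"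
  assumes "zfa_universe elts Atoms"
    and "countable Atoms" and "infinite Atoms"
    and "3 \<le> n"
  shows "\<exists>A \<in> VF0. \<exists>C \<in> VF0. \<exists>P \<in> VF0.
    zfa_structure.is_atom_set VF0 elts Atoms A \<and>
    zfa_structure.is_Cycles VF0 elts Atoms n A C \<and>
    zfa_structure.is_Part VF0 elts Atoms A P \<and>
    \<not> zfa_structure.card_le VF0 elts Atoms C P"
proof -
  interpret zfa_universe elts Atoms by fact
  interpret F: zfa_structure fraenkel_model elts Atoms .
  obtain A where A: "A \<in> fraenkel_model" "A \<notin> Atoms" "elts A = Atoms" "F.is_atom_set A"
    by (rule obtain_atom_set)
  obtain C where C: "C \<in> fraenkel_model" "F.is_Cycles n A C"
    using A(2,3) by (rule obtain_Cycles)
  obtain P where P: "P \<in> fraenkel_model" "F.is_Part A P"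
    using A(2,3) by (rule obtain_Part)
  have "\<not> F.card_le C P"
    using \<open>infinite Atoms\<close> \<open>3 \<le> n\<close> A(3) C(2) P(2) by (rule not_card_le_Cycles_Part)
  with A C P show ?thesis unfolding VF0_def by blast
qed

end
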